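(* Let assumptions (A1)-(A4) of the context hold and assume the system is asymptotically stable (i.e. $d=0$). Let $k\in\{1,\dots,N-1\}$ and let $\Omega_k$ be described by $\Omega_k=\{x\in\mathbb{R}^n: H_kx\le\mathbf{1}\}$ for a finite-dimensional matrix $H_k$. Then $\Omega_{k-1}$ can be described by $\Omega_{k-1}=\{x\in\mathbb{R}^n: H_{k-1}x\le\mathbf{1}\}$, where $$H_{k-1}=\begin{bmatrix}S_{k-1}C_{k-1}\\ H_kA_{k-1}\end{bmatrix}.$$ For $k=0$ the same holds with $k-1$ replaced by $N-1$: if $\Omega_0=\{x: H_0x\le\mathbf{1}\}$ with $H_0$ finite-dimensional, then $\Omega_{N-1}=\{x: H_{N-1}x\le\mathbf{1}\}$ with $H_{N-1}=\begin{bmatrix}S_{N-1}C_{N-1}\\ H_0A_{N-1}\end{bmatrix}$.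
   Context: Setting. Let $N\ge 1$ be an integer. Consider the discrete-time $N$-periodic system $x(t+1)=A(t)x(t)$, $y(t)=C(t)x(t)$, $t\in\mathbb{Z}^+=\{0,1,2,\dots\}$, with $x(t)\in\mathbb{R}^n$, $y(t)\in\mathbb{R}^p$, real matrices $A(t)\in\mathbb{R}^{n\times n}$, $C(t)\in\mathbb{R}^{p\times n}$, $A(t+N)=A(t)$, $C(t+N)=C(t)$. Write $A_k=A(k)$, $C_k=C(k)$ for $k=0,\dots,N-1$. The output is required to satisfy $y(t)\in\mathbb{Y}_{t \bmod N}$. Vector inequalities are componentwise, and $\mathbf{1}$ is the all-ones vector of appropriate dimension. Lifted matrices: $\Phi=A_{N-1}\cdots A_1A_0$, and $C$ is the block column with blocks $C_0,\ C_1A_0,\ \dots,\ C_{N-1}A_{N-2}\cdots A_0$. Assumptions. (A1) There is $d\in\mathbb{Z}^+$ such that for all $k$, $A_k=\begin{bmatrix}A_{k,s}&A_{k,c}\\ \mathbf{0}&I_d\end{bmatrix}$, $C_k=[C_{k,s}\ \ C_{k,c}]$. Consequently $\Phi=\begin{bmatrix}\Phi_s&\Phi_c\\ \mathbf{0}&I_d\end{bmatrix}$, $C=[C_s\ \ C_c]$, partitioned consistently. (When $d=0$, $A_k=A_{k,s}$, $C_k=C_{k,s}$, $\Phi=\Phi_s$.) (A2) All eigenvalues of $\Phi_s$ lie in the open unit disk. (A3) The pair $(C,\Phi)$ is observable. (A4) For each $k$, $\mathbb{Y}_k=\{y\in\mathbb{R}^p: S_ky\le\mathbf{1}\}$ is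 compact, where $S_k\in\mathbb{R}^{q_k\times p}$. Definition. For $k\in\{0,\dots,N-1\}$, $\Omega_k$ is the set of all $x_0\in\mathbb{R}^n$ such that the solution with $x(k)=x_0$ satisfies $y(t)\in\mathbb{Y}_{t \bmod N}$ for all $t\ge k$ (the maximal output-admissible set for timeslot $k$). *)

theory Defs
  imports
    "HOL-Analysis.Abstract_Euclidean_Space"
    "Jordan_Normal_Form.Char_Poly"
begin

text \<open>
  All block sizes are natural-number parameters (the number of rows of \<open>S\<^sub>k\<close> varies with \<open>k\<close>),
  so matrices and vectors are those of \<open>Jordan_Normal_Form\<close>.
\<close>

definition polyhedron1 :: "nat \<Rightarrow> real mat \<Rightarrow> real vec set" where
  \<comment> \<open>\<open>\<le>\<close> on vectors is componentwise, not lexicographic\<close>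
  "polyhedron1 n H = {x \<in> carrier_vec n. H *\<^sub>v x \<le> vec (dim_row H) (\<lambda>_. 1)}"

text \<open>\<open>carrier_vec p\<close> carries no topology; compactness is transported along the evident bijection
  onto the points of \<open>Euclidean_space p\<close>, which are the sequences vanishing from index \<open>p\<close> on.\<close>

definition compact_vecs :: "nat \<Rightarrow> real vec set \<Rightarrow> bool" where
  "compact_vecs p Y \<longleftrightarrow>
     compactin (Euclidean_space p) ((\<lambda>y i. if i < p then vec_index y i else 0) ` Y)"

fun state :: "(nat \<Rightarrow> real mat) \<Rightarrow> nat \<Rightarrow> real vec \<Rightarrow> nat \<Rightarrow> real vec" where
  \<comment> \<open>\<open>state A k x0 j\<close> is \<open>x(k + j)\<close> for the solution with \<open>x(k) = x0\<close>\<close>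
  "state A k x0 0 = x0"
| "state A k x0 (Suc j) = A (k + j) *\<^sub>v state A k x0 j"

definition max_output_admissible ::
  "nat \<Rightarrow> nat \<Rightarrow> (nat \<Rightarrow> real mat) \<Rightarrow> (nat \<Rightarrow> real mat) \<Rightarrow> (nat \<Rightarrow> real vec set) \<Rightarrow> nat \<Rightarrow> real vec set"
  where
  "max_output_admissible N n A C Y k =
     {x0 \<in> carrier_vec n. \<forall>j. C (k + j) *\<^sub>v state A k x0 j \<in> Y ((k + j) mod N)}"

fun transition :: "nat \<Rightarrow> (nat \<Rightarrow> real mat) \<Rightarrow> nat \<Rightarrow> real mat" where
  \<comment> \<open>\<open>transition n A m = A (m - 1) * \<dots> * A 0\<close>\<close>
  "transition n A 0 = 1\<^sub>m n"
| "transition n A (Suc m) = A m * transition n A m"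

definition lifted_A :: "nat \<Rightarrow> nat \<Rightarrow> (nat \<Rightarrow> real mat) \<Rightarrow> real mat" where
  "lifted_A N n A = transition n A N"

fun lifted_C :: "nat \<Rightarrow> nat \<Rightarrow> (nat \<Rightarrow> real mat) \<Rightarrow> (nat \<Rightarrow> real mat) \<Rightarrow> real mat" where
  \<comment> \<open>the blocks \<open>C 0\<close>, \<open>C 1 * A 0\<close>, \<open>\<dots>\<close>, \<open>C (N - 1) * A (N - 2) * \<dots> * A 0\<close>, stacked\<close>
  "lifted_C 0 n A C = 0\<^sub>m 0 n"
| "lifted_C (Suc m) n A C = lifted_C m n A C @\<^sub>r (C m * transition n A m)"

definition constant_states_split ::
  "nat \<Rightarrow> nat \<Rightarrow> nat \<Rightarrow> real mat \<Rightarrow> real mat \<Rightarrow> bool" where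
  "constant_states_split n p d Ak Ck \<longleftrightarrow>
     d \<le> n \<and>
     (\<exists>As\<in>carrier_mat (n - d) (n - d). \<exists>Ac\<in>carrier_mat (n - d) d.
        Ak = four_block_mat As Ac (0\<^sub>m d (n - d)) (1\<^sub>m d)) \<and>
     (\<exists>Cs\<in>carrier_mat p (n - d). \<exists>Cc\<in>carrier_mat p d.
        Ck = four_block_mat Cs Cc (0\<^sub>m 0 (n - d)) (0\<^sub>m 0 d))"

definition stable_block :: "nat \<Rightarrow> nat \<Rightarrow> real mat \<Rightarrow> real mat" where
  \<comment> \<open>the upper left block \<open>\<Phi>\<^sub>s\<close> of \<open>\<Phi>\<close>\<close>
  "stable_block n d \<Phi> = fst (split_block \<Phi> (n - d) (n - d))"

definition eigenvalues_in_unit_disk :: "real mat \<Rightarrow> bool" where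
  "eigenvalues_in_unit_disk M \<longleftrightarrow>
     (\<forall>z::complex. eigenvalue (map_mat complex_of_real M) z \<longrightarrow> cmod z < 1)"

definition observable :: "nat \<Rightarrow> real mat \<Rightarrow> real mat \<Rightarrow> bool" where
  "observable n C \<Phi> \<longleftrightarrow>
     (\<forall>x\<in>carrier_vec n. \<forall>x'\<in>carrier_vec n.
        (\<forall>i. C *\<^sub>v ((\<Phi> ^\<^sub>m i) *\<^sub>v x) = C *\<^sub>v ((\<Phi> ^\<^sub>m i) *\<^sub>v x')) \<longrightarrow> x = x')"

end

theory Submission
  imports Defs
begin

text \<open>
  A trajectory starting from \<open>x\<close> at time \<open>k\<close> consists of its first point, with output \<open>C k x\<close>, and of
  the trajectory starting from \<open>A k x\<close> at time \<open>k + 1\<close>. Hence \<open>x\<close> is admissible at \<open>k\<close> if and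
  only if \<open>C k x\<close> is an allowed output and \<open>A k x\<close> is admissible at \<open>k + 1\<close>
  (\<open>max_output_admissible_Suc\<close>). If \<open>H\<close> describes the admissible set at \<open>k + 1\<close>, both conditions say
  that a linear map sends \<open>x\<close> into a polyhedron, so their conjunction is again a polyhedron, whose
  rows are those of \<open>S k * C k\<close> on top of those of \<open>H * A k\<close> (\<open>polyhedron1_append_rows\<close>). This is
  the step from one slot to the preceding one within a period; for the step from slot
  \<open>0\<close> to slot \<open>N - 1\<close>, periodicity identifies time \<open>N\<close> with time \<open>0\<close>
  (\<open>max_output_admissible_periodic\<close>).
\<close>

lemma state_Suc_start: "state A k x (Suc j) = state A (Suc k) (A k *\<^sub>v x) j"
  by (induction j) simp_all

lemma max_output_admissible_Suc:
  assumes A: "A k \<in> carrier_mat n n"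
  shows "max_output_admissible N n A C Y k =
    {x \<in> carrier_vec n. C k *\<^sub>v x \<in> Y (k mod N) \<and>
       A k *\<^sub>v x \<in> max_output_admissible N n A C Y (Suc k)}"
proof -
  have split_first: "(\<forall>j. P j) \<longleftrightarrow> P 0 \<and> (\<forall>j. P (Suc j))" for P :: "nat \<Rightarrow> bool"
    by (metis not0_implies_Suc)
  have "(\<forall>j. C (k + j) *\<^sub>v state A k x j \<in> Y ((k + j) mod N)) \<longleftrightarrow>
      C k *\<^sub>v x \<in> Y (k mod N) \<and>
      (\<forall>j. C (Suc k + j) *\<^sub>v state A (Suc k) (A k *\<^sub>v x) j \<in> Y ((Suc k + j) mod N))" for x
    by (subst split_first) (simp add: state_Suc_start del: state.simps(2))
  then show ?thesis
    using A by (auto simp: max_output_admissible_def)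
qed

lemma max_output_admissible_periodic:
  assumes A: "\<forall>t. A (t + N) = A t" and C: "\<forall>t. C (t + N) = C t"
  shows "max_output_admissible N n A C Y (k + N) = max_output_admissible N n A C Y k"
proof -
  have shift: "k + N + j = (k + j) + N" for j
    by simp
  have "state A (k + N) x j = state A k x j" for x j
    using A by (induction j) (simp_all add: shift del: add.assoc)
  then show ?thesis
    using C by (simp add: max_output_admissible_def shift del: add.assoc)
qed

text \<open>A polyhedron pulls back along a linear map by multiplying its matrix with that of the map, and
  stacking rows intersects polyhedra.\<close>

lemma polyhedron1_append_rows:
  assumes S: "S \<in> carrier_mat q p" and C: "C \<in> carrier_mat p n"
    and H: "H \<in> carrier_mat m n'" and A: "A \<in> carrier_mat n' n"
  shows "polyhedron1 n ((S * C) @\<^sub>r (H * A)) =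
    {x \<in> carrier_vec n. C *\<^sub>v x \<in> polyhedron1 p S \<and> A *\<^sub>v x \<in> polyhedron1 n' H}"
proof -
  have ones: "vec (q + m) (\<lambda>_. 1 :: real) = vec q (\<lambda>_. 1) @\<^sub>v vec m (\<lambda>_. 1)"
    by (rule eq_vecI) auto
  have SC: "S * C \<in> carrier_mat q n" and HA: "H * A \<in> carrier_mat m n"
    using assms by auto
  have rows: "dim_row ((S * C) @\<^sub>r (H * A)) = q + m"
    using carrier_append_rows[OF SC HA] by blast
  have "((S * C) @\<^sub>r (H * A)) *\<^sub>v x \<le> vec (q + m) (\<lambda>_. 1) \<longleftrightarrow>
      S *\<^sub>v (C *\<^sub>v x) \<le> vec q (\<lambda>_. 1) \<and> H *\<^sub>v (A *\<^sub>v x) \<le> vec m (\<lambda>_. 1)"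
    if x: "x \<in> carrier_vec n" for x
    unfolding ones append_rows_le[OF SC HA vec_carrier x]
    using assoc_mult_mat_vec[OF S C x] assoc_mult_mat_vec[OF H A x] by simp
  then show ?thesis
    using assms rows by (auto simp: polyhedron1_def)
qed

text \<open>The successor time is not reduced modulo \<open>N\<close>, so the case \<open>Suc k = N\<close> covers the step that
  crosses the end of a period.\<close>

lemma max_output_admissible_backward_step:
  assumes A: "A k \<in> carrier_mat n n" and C: "C k \<in> carrier_mat p n"
    and S: "S k \<in> carrier_mat r p" and k: "k < N"
    and H: "H \<in> carrier_mat m n"
    and next_slot: "max_output_admissible N n A C (\<lambda>k. polyhedron1 p (S k)) (Suc k) = polyhedron1 n H"
  shows "max_output_admissible N n A C (\<lambda>k. polyhedron1 p (S k)) k =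
    polyhedron1 n ((S k * C k) @\<^sub>r (H * A k))"
  unfolding max_output_admissible_Suc[of A, OF A] next_slot polyhedron1_append_rows[OF S C H A]
  using k by simp

theorem theorem3:
  fixes N n p d :: nat
    and q :: "nat \<Rightarrow> nat"
    and A C S :: "nat \<Rightarrow> real mat"
  defines "Y \<equiv> \<lambda>k. polyhedron1 p (S k)"
  defines "\<Omega> \<equiv> max_output_admissible N n A C Y"
  assumes "1 \<le> N"
    and "\<forall>t. A t \<in> carrier_mat n n" "\<forall>t. C t \<in> carrier_mat p n"
    and "\<forall>t. A (t + N) = A t" "\<forall>t. C (t + N) = C t"
    and "\<forall>k<N. S k \<in> carrier_mat (q k) p"
    and A1: "\<forall>k<N. constant_states_split n p d (A k) (C k)"
    and A2: "eigenvalues_in_unit_disk (stable_block n d (lifted_A N n A))"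
    and A3: "observable n (lifted_C N n A C) (lifted_A N n A)"
    and A4: "\<forall>k<N. compact_vecs p (Y k)"
    and asymptotically_stable: "d = 0"
  shows "(\<forall>k m H. 1 \<le> k \<and> k \<le> N - 1 \<and> H \<in> carrier_mat m n \<and> \<Omega> k = polyhedron1 n H \<longrightarrow>
            \<Omega> (k - 1) = polyhedron1 n ((S (k - 1) * C (k - 1)) @\<^sub>r (H * A (k - 1)))) \<and>
         (\<forall>m H. H \<in> carrier_mat m n \<and> \<Omega> 0 = polyhedron1 n H \<longrightarrow>
            \<Omega> (N - 1) = polyhedron1 n ((S (N - 1) * C (N - 1)) @\<^sub>r (H * A (N - 1))))"
proof (intro conjI allI impI; elim conjE)
  fix k m H
  assume k: "1 \<le> k" "k \<le> N - 1" and H: "H \<in> carrier_mat m n" and \<Omega>k: "\<Omega> k = polyhedron1 n H"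
  have "k - 1 < N" "Suc (k - 1) = k"
    using k by auto
  then show "\<Omega> (k - 1) = polyhedron1 n ((S (k - 1) * C (k - 1)) @\<^sub>r (H * A (k - 1)))"
    using assms H \<Omega>k unfolding \<Omega>_def Y_def
    by (intro max_output_admissible_backward_step[where r = "q (k - 1)"]) auto
next
  fix m H
  assume H: "H \<in> carrier_mat m n" and \<Omega>0: "\<Omega> 0 = polyhedron1 n H"
  have last: "N - 1 < N" "Suc (N - 1) = N"
    using \<open>1 \<le> N\<close> by auto
  have "\<Omega> N = polyhedron1 n H"
    using max_output_admissible_periodic[of A N C n Y 0] assms(6,7) \<Omega>0 by (simp add: \<Omega>_def)
  then show "\<Omega> (N - 1) = polyhedron1 n ((S (N - 1) * C (N - 1)) @\<^sub>r (H * A (N - 1)))"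
    using last assms H unfolding \<Omega>_def Y_def
    by (intro max_output_admissible_backward_step[where r = "q (N - 1)"]) auto
qed

end
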